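(* Let $(\mathbf{r}_{k+1},\mathbf{x}_{k+1},\mathbf{s}_{k+1},\mathbf{y}_{k+1})_{k\ge 1}$ be generated by the algorithm FWLP-P described in the context, started from $\mathbf{x}_1\in\mathbb{R}^n$, $\mathbf{x}_1\ge\mathbf{0}$, and $\mathbf{y}_1\in\mathbb{R}^m$. For $k\ge 2$ let $$U_k:= -\mathbf{r}_{k+1}^\top(\mathbf{c}-A^\top\mathbf{y}_k)-\frac{1}{2\sqrt{k}}\Vert\mathbf{r}_{k+1}\Vert^2+\mathbf{s}_k^\top(\mathbf{b}-A\mathbf{x}_k) - \frac{1}{2\sqrt{k}}\Vert\mathbf{s}_k\Vert^2 + \mathbf{c}^\top\mathbf{x}_k-\mathbf{b}^\top\mathbf{y}_k .$$ Suppose $\xi\ge 2\Vert\mathbf{x}^*\Vert_1$ and $\eta\ge 2\Vert\mathbf{y}^*\Vert_\infty$, where $(\mathbf{x}^*,\mathbf{y}^* )$ is an optimal primal-dual pair. Then for every $k\ge 2$, $$\mathbf{x}_k\ge\mathbf{0},$$ $$\Vert\mathbf{b}-A\mathbf{x}_k\Vert_1 \le \frac{2U_k}{\eta} + \frac{\xi^2}{\eta\sqrt{k}} + \frac{m\eta}{\sqrt{k-1}},$$ $$\max\big(0,\max_{1\le j\le n}\mathbf{e}_j^\top(A^\top\mathbf{y}_k-\mathbf{c})\big) \le \frac{2U_k}{\xi} + \frac{\xi}{\sqrt{k}} + \frac{m\eta^2}{\xi\sqrt{k-1}},$$ $$\mathbf{c}^\top\mathbf{x}_k-\mathbf{b}^\top\mathbf{y}_k\le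 U_k.$$
   Context: Let $A\in\mathbb{R}^{m\times n}$, $\mathbf{b}\in\mathbb{R}^m$, $\mathbf{c}\in\mathbb{R}^n$. The primal linear program is $\min\{\mathbf{c}^\top\mathbf{x}: A\mathbf{x}=\mathbf{b},\ \mathbf{x}\ge\mathbf{0}\}$ and its dual is $\max\{\mathbf{b}^\top\mathbf{y}: A^\top\mathbf{y}\le\mathbf{c}\}$; the primal is assumed to have an optimal solution, and $(\mathbf{x}^*,\mathbf{y}^* )$ denotes an optimal primal-dual pair. For parameters $\xi,\eta>0$ set $\Delta=\{\mathbf{x}\in\mathbb{R}^n:\mathbf{x}\ge\mathbf{0},\ \mathbf{e}^\top\mathbf{x}\le\xi\}$, where $\mathbf{e}$ is the all-ones vector, and $\Gamma=[-\eta,\eta]^m$. Unsubscripted $\Vert\cdot\Vert$ is the Euclidean norm; $\mathbf{e}_j$ is the $j$th column of the identity matrix. Algorithm FWLP-P: given starting points $\mathbf{x}_1,\mathbf{y}_1$, for $k=1,2,\dots$ compute $$\mathbf{r}_{k+1} := \operatorname{argmin}_{\mathbf{r}\in\Delta}\Big\{(\mathbf{c}-A^\top\mathbf{y}_k)^\top\mathbf{r} + \tfrac{\Vert \mathbf{r}\Vert^2}{2\sqrt{k}}\Big\},\qquad \mathbf{x}_{k+1}:=\tfrac{k}{k+1}\mathbf{x}_k + \tfrac{1}{k+1}\mathbf{r}_{k+1},$$ $$\mathbf{s}_{k+1}:=\operatorname{argmax}_{\mathbf{s}\in\Gamma}\Big\{(\mathbf{b}-A\mathbf{x}_{k+1})^\top\mathbf{s}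 -\tfrac{\Vert\mathbf{s}\Vert^2}{2\sqrt{k}}\Big\},\qquad \mathbf{y}_{k+1}:=\tfrac{k}{k+1}\mathbf{y}_k+\tfrac{1}{k+1}\mathbf{s}_{k+1}.$$ *)

theory Defs
  imports "HOL-Analysis.Analysis"
begin

text \<open>The order on \<open>real ^ 'n\<close> is componentwise.
  The Euclidean norm is \<open>norm\<close> and the maximum norm is the library's \<open>infnorm\<close>.\<close>

definition l1_norm :: "real ^ 'n \<Rightarrow> real" where
  "l1_norm x = (\<Sum>i\<in>UNIV. \<bar>x $ i\<bar>)"

definition primal_feasible :: "real ^ 'n ^ 'm \<Rightarrow> real ^ 'm \<Rightarrow> (real ^ 'n) set" where
  "primal_feasible A b = {x. A *v x = b \<and> 0 \<le> x}"

definition dual_feasible :: "real ^ 'n ^ 'm \<Rightarrow> real ^ 'n \<Rightarrow> (real ^ 'm) set" where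
  "dual_feasible A c = {y. transpose A *v y \<le> c}"

text \<open>Optimality is stated separately for each program; equality of the optimal values
  is not part of the definition.\<close>

definition optimal_pair ::
  "real ^ 'n ^ 'm \<Rightarrow> real ^ 'm \<Rightarrow> real ^ 'n \<Rightarrow> real ^ 'n \<Rightarrow> real ^ 'm \<Rightarrow> bool" where
  "optimal_pair A b c x y \<longleftrightarrow>
     is_arg_min (\<lambda>x. c \<bullet> x) (\<lambda>x. x \<in> primal_feasible A b) x \<and>
     is_arg_max (\<lambda>y. b \<bullet> y) (\<lambda>y. y \<in> dual_feasible A c) y"

definition Delta_set :: "real \<Rightarrow> (real ^ 'n) set" where
  "Delta_set \<xi> = {x. 0 \<le> x \<and> vec 1 \<bullet> x \<le> \<xi>}"

definition Gamma_set :: "real \<Rightarrow> (real ^ 'm) set" where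
  "Gamma_set \<eta> = {s. \<forall>i. s $ i \<in> {-\<eta>..\<eta>}}"

text \<open>Sequences are functions on \<open>nat\<close>, but \<open>x\<close>, \<open>y\<close> are only
  meaningful from index 1 and \<open>r\<close>, \<open>s\<close> from index 2; earlier values are unconstrained.
  Both subproblems are strictly convex over nonempty compact sets, so the minimiser and
  maximiser exist and are unique.\<close>

definition fwlp_p ::
  "real ^ 'n ^ 'm \<Rightarrow> real ^ 'm \<Rightarrow> real ^ 'n \<Rightarrow> real \<Rightarrow> real \<Rightarrow>
   (nat \<Rightarrow> real ^ 'n) \<Rightarrow> (nat \<Rightarrow> real ^ 'n) \<Rightarrow> (nat \<Rightarrow> real ^ 'm) \<Rightarrow> (nat \<Rightarrow> real ^ 'm) \<Rightarrow> bool" where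
  "fwlp_p A b c \<xi> \<eta> r x s y \<longleftrightarrow> (\<forall>k\<ge>1.
     is_arg_min (\<lambda>v. (c - transpose A *v y k) \<bullet> v + (norm v)\<^sup>2 / (2 * sqrt (real k)))
       (\<lambda>v. v \<in> Delta_set \<xi>) (r (k + 1)) \<and>
     x (k + 1) = (real k / (real k + 1)) *\<^sub>R x k + (1 / (real k + 1)) *\<^sub>R r (k + 1) \<and>
     is_arg_max (\<lambda>v. (b - A *v x (k + 1)) \<bullet> v - (norm v)\<^sup>2 / (2 * sqrt (real k)))
       (\<lambda>v. v \<in> Gamma_set \<eta>) (s (k + 1)) \<and>
     y (k + 1) = (real k / (real k + 1)) *\<^sub>R y k + (1 / (real k + 1)) *\<^sub>R s (k + 1))"

text \<open>Both quadratic terms carry the same factor \<open>1 / (2 * sqrt k)\<close>, although \<open>s k\<close>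
  is computed with \<open>sqrt (k - 1)\<close>.\<close>

definition fwlp_U ::
  "real ^ 'n ^ 'm \<Rightarrow> real ^ 'm \<Rightarrow> real ^ 'n \<Rightarrow>
   (nat \<Rightarrow> real ^ 'n) \<Rightarrow> (nat \<Rightarrow> real ^ 'n) \<Rightarrow> (nat \<Rightarrow> real ^ 'm) \<Rightarrow> (nat \<Rightarrow> real ^ 'm) \<Rightarrow>
   nat \<Rightarrow> real" where
  "fwlp_U A b c r x s y k =
     - (r (k + 1) \<bullet> (c - transpose A *v y k)) - 1 / (2 * sqrt (real k)) * (norm (r (k + 1)))\<^sup>2
     + s k \<bullet> (b - A *v x k) - 1 / (2 * sqrt (real k)) * (norm (s k))\<^sup>2
     + c \<bullet> x k - b \<bullet> y k"

end

theory Submission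
  imports Defs
begin

text \<open>
  The bounds come from a lower estimate of \<open>U\<close>. Write \<open>p = b - A x\<^sub>k\<close> for the primal residual,
  \<open>P\<close> for its 1-norm, and \<open>D\<close> for the largest violation of a dual constraint at \<open>y\<^sub>k\<close>, which is
  0 if there is none.

  The quantity \<open>U\<close> is the sum of the duality gap \<open>c \<bullet> x\<^sub>k - b \<bullet> y\<^sub>k\<close>, the negated optimal value of
  the \<open>r\<close>-subproblem, and a third term, which is at least the optimal value of the \<open>s\<close>-subproblem
  (\<open>fwlp_U_ge\<close>). The last two are nonnegative since \<open>0\<close> is a feasible test point, so \<open>U\<close>
  dominates the gap. Better test points, a vertex of the simplex (the origin or some \<open>\<xi> e\<^sub>j\<close>) and
  the point \<open>\<eta> sgn p\<close> of the box, show that the two terms are at least \<open>\<xi> D\<close> and \<open>\<eta> P\<close>, up to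
  the regularisation errors \<open>\<xi>\<^sup>2 / (2 \<surd>k)\<close> and \<open>m \<eta>\<^sup>2 / (2 \<surd>(k-1))\<close>
  (\<open>test_point_primal\<close>, \<open>test_point_dual\<close>).

  The gap itself may be negative, but not by much. Since \<open>x\<^sub>k \<ge> 0\<close>, strong duality
  \<open>c \<bullet> x\<^sup>* = b \<bullet> y\<^sup>*\<close> splits it into \<open>- (y\<^sup>* \<bullet> p)\<close> and \<open>- ((A\<^sup>T y\<^sub>k - c) \<bullet> x\<^sup>*)\<close> plus a
  nonnegative term, and Hoelder's inequality bounds it below by \<open>- \<eta> P / 2 - \<xi> D / 2\<close>
  (\<open>duality_gap_lower_bound\<close>). The factor 2 in \<open>\<xi> \<ge> 2 \<parallel>x\<^sup>*\<parallel>\<^sub>1\<close> and \<open>\<eta> \<ge> 2 \<parallel>y\<^sup>*\<parallel>\<^sub>\<infinity>\<close> thus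
  leaves \<open>\<xi> D / 2 + \<eta> P / 2\<close> below \<open>U\<close> plus the errors, which bounds \<open>P\<close> and \<open>D\<close> alike.

  Strong duality comes from Farkas' lemma, which in turn is the separation of a point
  from a finitely generated, hence closed, convex cone.
\<close>

section \<open>Linear programming duality\<close>

lemma farkas:
  fixes S :: "'a::euclidean_space set"
  assumes "finite S" and "z \<notin> convex_cone hull S"
  obtains a where "a \<bullet> z < 0" and "\<And>g. g \<in> S \<Longrightarrow> 0 \<le> a \<bullet> g"
proof -
  let ?K = "convex_cone hull S"
  obtain a \<beta> where az: "a \<bullet> z < \<beta>" and aK: "\<forall>u\<in>?K. \<beta> < a \<bullet> u"
    using separating_hyperplane_closed_point[OF convex_convex_cone_hull
        closed_convex_cone_hull[OF assms(1)] assms(2)] by blast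
  have "\<beta> < 0"
    using aK convex_cone_hull_contains_0 by force
  moreover have "0 \<le> a \<bullet> g" if "g \<in> S" for g
  proof (rule ccontr)
    assume neg: "\<not> 0 \<le> a \<bullet> g"
    \<comment> \<open>Otherwise the multiple of \<open>g\<close> on which \<open>a\<close> takes the value \<open>\<beta>\<close> lies in the cone.\<close>
    have "(\<beta> / (a \<bullet> g)) *\<^sub>R g \<in> ?K"
      using that neg \<open>\<beta> < 0\<close>
      by (intro convex_cone_hull_mul hull_inc) (auto simp: divide_nonpos_neg)
    with aK have "\<beta> < a \<bullet> ((\<beta> / (a \<bullet> g)) *\<^sub>R g)" by blast
    with neg show False by simp
  qed
  ultimately show thesis
    using that az by force
qed

lemma inner_transpose_mult:
  fixes A :: "real ^ 'n ^ 'm"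
  shows "(transpose A *v y) \<bullet> x = y \<bullet> (A *v x)"
  by (simp add: dot_lmul_matrix)

lemma inner_nonneg_vec:
  fixes u v :: "real ^ 'n"
  assumes "0 \<le> u" and "0 \<le> v"
  shows "0 \<le> u \<bullet> v"
  using assms by (auto simp: inner_vec_def less_eq_vec_def intro!: sum_nonneg)

lemma weak_duality:
  assumes "x \<in> primal_feasible A b" and "y \<in> dual_feasible A c"
  shows "b \<bullet> y \<le> c \<bullet> x"
proof -
  have "0 \<le> (c - transpose A *v y) \<bullet> x"
    using assms by (intro inner_nonneg_vec) (auto simp: primal_feasible_def dual_feasible_def)
  then show ?thesis
    using assms by (simp only: inner_diff_left inner_transpose_mult)
      (simp add: primal_feasible_def inner_commute)
qed

text \<open>If the optima differed, take \<open>w\<close> strictly between them. No primal feasible point has cost at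
  most \<open>w\<close>, so \<open>(b, w)\<close> is outside the cone generated by the columns of \<open>A\<close>, each paired
  with its cost, and the slack direction \<open>(0, 1)\<close>. A separating functional \<open>(u, t)\<close> then
  either has \<open>t > 0\<close>, and \<open>- u / t\<close> is a dual feasible point of value above \<open>w\<close>, or has
  \<open>t = 0\<close>, and \<open>u\<close> certifies that the primal is infeasible; both are impossible.\<close>

lemma strong_duality:
  fixes A :: "real ^ 'n ^ 'm"
  assumes "optimal_pair A b c xopt yopt"
  shows "c \<bullet> xopt = b \<bullet> yopt"
proof (rule antisym)
  from assms have xfeas: "xopt \<in> primal_feasible A b"
    and xmin: "\<And>x. x \<in> primal_feasible A b \<Longrightarrow> c \<bullet> xopt \<le> c \<bullet> x"
    and yfeas: "yopt \<in> dual_feasible A c"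
    and ymax: "\<And>y. y \<in> dual_feasible A c \<Longrightarrow> b \<bullet> y \<le> b \<bullet> yopt"
    by (auto simp: optimal_pair_def is_arg_min_linorder is_arg_max_linorder)
  show "b \<bullet> yopt \<le> c \<bullet> xopt"
    using xfeas yfeas by (rule weak_duality)
  show "c \<bullet> xopt \<le> b \<bullet> yopt"
  proof (rule ccontr)
    assume "\<not> c \<bullet> xopt \<le> b \<bullet> yopt"
    then obtain w where w: "b \<bullet> yopt < w" "w < c \<bullet> xopt"
      using dense by (metis not_le)
    define S where "S = insert (0, 1) (range (\<lambda>j. (A *v axis j 1, c $ j)))"
    define K where "K = {(A *v x, t) | x t. 0 \<le> x \<and> c \<bullet> x \<le> t}"
    have "convex_cone K"
      unfolding convex_cone_iff
    proof (intro conjI ballI allI impI)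
      have "(A *v 0, 0) \<in> K"
        unfolding K_def by fastforce
      then show "0 \<in> K" by (simp add: zero_prod_def)
    next
      fix p q assume "p \<in> K" "q \<in> K"
      then obtain x t x' t' where "p = (A *v x, t)" "0 \<le> x" "c \<bullet> x \<le> t"
        "q = (A *v x', t')" "0 \<le> x'" "c \<bullet> x' \<le> t'"
        unfolding K_def by blast
      moreover from this have "p + q = (A *v (x + x'), t + t')" "c \<bullet> (x + x') \<le> t + t'"
        by (auto simp: matrix_vector_right_distrib inner_add_right)
      ultimately show "p + q \<in> K"
        unfolding K_def using add_nonneg_nonneg by blast
    next
      fix p and a :: real assume "p \<in> K" "a \<ge> 0"
      then obtain x t where "p = (A *v x, t)" "0 \<le> x" "c \<bullet> x \<le> t"
        unfolding K_def by blast
      moreover from this \<open>a \<ge> 0\<close> have "a *\<^sub>R p = (A *v (a *\<^sub>R x), a * t)" "c \<bullet> (a *\<^sub>R x) \<le> a * t"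
        "0 \<le> a *\<^sub>R x"
        by (auto simp: matrix_vector_mult_scaleR mult_left_mono less_eq_vec_def)
      ultimately show "a *\<^sub>R p \<in> K"
        unfolding K_def by blast
    qed
    moreover have "S \<subseteq> K"
    proof -
      have "(A *v 0, 1) \<in> K"
        unfolding K_def by fastforce
      moreover have "(A *v axis j 1, c $ j) \<in> K" for j
      proof -
        have "0 \<le> (axis j 1 :: real ^ 'n)" and "c \<bullet> axis j 1 \<le> c $ j"
          by (simp add: less_eq_vec_def axis_def, simp add: inner_axis)
        then show ?thesis
          unfolding K_def by blast
      qed
      ultimately show ?thesis
        unfolding S_def by auto
    qed
    ultimately have "convex_cone hull S \<subseteq> K"
      by (rule hull_minimal[rotated])
    moreover have "(b, w) \<notin> K"
    proof
      assume "(b, w) \<in> K"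
      then obtain x where "x \<in> primal_feasible A b" "c \<bullet> x \<le> w"
        unfolding K_def primal_feasible_def by auto
      with xmin[of x] w show False by linarith
    qed
    ultimately have "(b, w) \<notin> convex_cone hull S"
      by blast
    moreover have "finite S"
      by (simp add: S_def)
    ultimately obtain a where "a \<bullet> (b, w) < 0" "\<And>g. g \<in> S \<Longrightarrow> 0 \<le> a \<bullet> g"
      by (metis farkas)
    then obtain u t where neg: "(u, t) \<bullet> (b, w) < 0"
      and pos: "\<And>g. g \<in> S \<Longrightarrow> 0 \<le> (u, t) \<bullet> g"
      by (metis prod.exhaust)
    have "0 \<le> t"
      using pos[of "(0, 1)"] by (simp add: S_def)
    have col: "0 \<le> (transpose A *v u) $ j + t * c $ j" for j
    proof -
      have "(A *v axis j 1, c $ j) \<in> S"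
        by (simp add: S_def)
      from pos[OF this] show ?thesis
        by (simp only: inner_Pair inner_transpose_mult[symmetric])
          (simp add: inner_axis)
    qed
    show False
    proof (cases "t = 0")
      case True
      with col have "0 \<le> transpose A *v u"
        by (simp add: less_eq_vec_def)
      then have "0 \<le> (transpose A *v u) \<bullet> xopt"
        using xfeas by (intro inner_nonneg_vec) (auto simp: primal_feasible_def)
      with xfeas have "0 \<le> u \<bullet> b"
        by (simp only: inner_transpose_mult) (simp add: primal_feasible_def)
      with neg True show False by simp
    next
      case False
      with \<open>0 \<le> t\<close> have "0 < t" by simp
      define y where "y = (- 1 / t) *\<^sub>R u"
      have "(transpose A *v y) $ j \<le> c $ j" for j
      proof -
        have "(transpose A *v y) $ j = - ((transpose A *v u) $ j) / t"
          unfolding y_def matrix_vector_mult_scaleR by simp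
        then show ?thesis
          using col[of j] \<open>0 < t\<close> by (simp only: pos_divide_le_eq) (simp add: mult.commute)
      qed
      then have "y \<in> dual_feasible A c"
        by (simp add: dual_feasible_def less_eq_vec_def)
      from ymax[OF this] w have "b \<bullet> y < w" by linarith
      then show False
        using neg \<open>0 < t\<close> by (simp add: y_def inner_commute field_simps)
    qed
  qed
qed

section \<open>Hoelder inequalities and the test points attaining them\<close>

definition max_violation :: "real ^ 'n \<Rightarrow> real" where
  "max_violation g = max 0 (MAX j\<in>UNIV. axis j 1 \<bullet> g)"

lemma max_violation_nonneg: "0 \<le> max_violation g"
  by (simp add: max_violation_def)

lemma component_le_max_violation: "g $ j \<le> max_violation g"
proof -
  have "axis j 1 \<bullet> g \<le> (MAX j\<in>UNIV. axis j 1 \<bullet> g)"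
    by (rule Max_ge) auto
  then show ?thesis
    by (simp add: max_violation_def inner_axis' max.coboundedI2)
qed

lemma l1_norm_nonneg: "0 \<le> l1_norm x"
  by (simp add: l1_norm_def sum_nonneg)

lemma inner_le_max_violation_l1:
  assumes "0 \<le> x"
  shows "g \<bullet> x \<le> max_violation g * l1_norm x"
proof -
  have "g $ j * x $ j \<le> max_violation g * \<bar>x $ j\<bar>" for j
    using mult_right_mono[OF component_le_max_violation, of "x $ j" g j] assms
    by (simp add: less_eq_vec_def)
  then show ?thesis
    by (auto simp: inner_vec_def l1_norm_def sum_distrib_left intro!: sum_mono)
qed

lemma inner_le_infnorm_l1:
  fixes y p :: "real ^ 'm"
  shows "y \<bullet> p \<le> infnorm y * l1_norm p"
proof -
  have "y $ i * p $ i \<le> infnorm y * \<bar>p $ i\<bar>" for i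
  proof -
    have "y $ i * p $ i \<le> \<bar>y $ i\<bar> * \<bar>p $ i\<bar>"
      by (metis abs_ge_self abs_mult)
    also have "\<dots> \<le> infnorm y * \<bar>p $ i\<bar>"
      by (intro mult_right_mono component_le_infnorm_cart) simp
    finally show ?thesis .
  qed
  then show ?thesis
    by (auto simp: inner_vec_def l1_norm_def sum_distrib_left intro!: sum_mono)
qed

text \<open>A linear function is maximised over the simplex at a vertex, and over the box at the point
  given by the signs of its coefficients. The norm bounds on these two maximisers limit the error
  that the quadratic regularisation adds to the maximum of the linear function.\<close>

lemma test_point_primal:
  fixes g :: "real ^ 'n"
  assumes "0 < \<xi>"
  obtains v where "v \<in> Delta_set \<xi>" and "g \<bullet> v = \<xi> * max_violation g" and "(norm v)\<^sup>2 \<le> \<xi>\<^sup>2"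
proof (cases "max_violation g = 0")
  case True
  \<comment> \<open>Every component is nonpositive, so the origin is the best point of the simplex.\<close>
  show thesis
    by (rule that[of 0]) (use assms True in \<open>auto simp: Delta_set_def\<close>)
next
  case False
  have "(MAX j\<in>UNIV. axis j 1 \<bullet> g) \<in> range (\<lambda>j. axis j 1 \<bullet> g)"
    by (rule Max_in) auto
  then obtain j where "(MAX j\<in>UNIV. axis j 1 \<bullet> g) = axis j 1 \<bullet> g"
    by (rule imageE)
  with False have j: "max_violation g = g $ j"
    unfolding max_violation_def by (simp add: inner_axis' max_def split: if_splits)
  show thesis
  proof (rule that[of "\<xi> *\<^sub>R axis j 1"])
    have "0 \<le> \<xi> *\<^sub>R (axis j 1 :: real ^ 'n)"
      using assms by (simp add: less_eq_vec_def axis_def)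
    then show "\<xi> *\<^sub>R axis j 1 \<in> Delta_set \<xi>"
      by (simp add: Delta_set_def inner_axis)
    show "g \<bullet> (\<xi> *\<^sub>R axis j 1) = \<xi> * max_violation g"
      by (simp add: j inner_axis)
    show "(norm (\<xi> *\<^sub>R (axis j 1 :: real ^ 'n)))\<^sup>2 \<le> \<xi>\<^sup>2"
      by simp
  qed
qed

lemma test_point_dual:
  fixes p :: "real ^ 'm"
  assumes "0 < \<eta>"
  obtains v where "v \<in> Gamma_set \<eta>" and "p \<bullet> v = \<eta> * l1_norm p"
    and "(norm v)\<^sup>2 \<le> real CARD('m) * \<eta>\<^sup>2"
proof
  let ?v = "\<chi> i. \<eta> * sgn (p $ i)"
  show "?v \<in> Gamma_set \<eta>"
    using assms by (auto simp: Gamma_set_def sgn_if)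
  have "p $ i * (\<eta> * sgn (p $ i)) = \<eta> * \<bar>p $ i\<bar>" for i
    by (simp add: abs_sgn mult.left_commute)
  then show "p \<bullet> ?v = \<eta> * l1_norm p"
    by (simp only: inner_vec_def l1_norm_def sum_distrib_left inner_real_def vec_lambda_beta)
  have "(\<eta> * sgn (p $ i))\<^sup>2 \<le> \<eta>\<^sup>2" for i
    by (auto simp: sgn_if)
  then have "(\<Sum>i\<in>UNIV. (\<eta> * sgn (p $ i))\<^sup>2) \<le> (\<Sum>i\<in>(UNIV::'m set). \<eta>\<^sup>2)"
    by (intro sum_mono)
  then show "(norm ?v)\<^sup>2 \<le> real CARD('m) * \<eta>\<^sup>2"
    unfolding power2_norm_eq_inner by (simp add: inner_vec_def power2_eq_square)
qed

section \<open>The duality gap at an infeasible pair\<close>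

text \<open>Optimal multipliers price infeasibility: a super-optimal primal objective is paid for by the
  residual at rate \<open>yopt\<close>, a super-optimal dual objective by the constraint violation at rate
  \<open>xopt\<close>.\<close>

lemma duality_gap_lower_bound:
  fixes A :: "real ^ 'n ^ 'm"
  assumes opt: "optimal_pair A b c xopt yopt" and "0 \<le> x"
  shows "- (infnorm yopt * l1_norm (b - A *v x))
      - max_violation (transpose A *v y - c) * l1_norm xopt \<le> c \<bullet> x - b \<bullet> y"
proof -
  from opt have xfeas: "A *v xopt = b" "0 \<le> xopt" and yfeas: "transpose A *v yopt \<le> c"
    by (auto simp: optimal_pair_def is_arg_min_def is_arg_max_def
        primal_feasible_def dual_feasible_def)
  have "0 \<le> (c - transpose A *v yopt) \<bullet> x"
    using yfeas \<open>0 \<le> x\<close> by (intro inner_nonneg_vec) auto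
  then have "yopt \<bullet> (A *v x) \<le> c \<bullet> x"
    by (simp only: inner_diff_left inner_transpose_mult)
  then have 1: "b \<bullet> yopt - yopt \<bullet> (b - A *v x) \<le> c \<bullet> x"
    by (simp add: inner_diff_right inner_commute)
  have 2: "(transpose A *v y - c) \<bullet> xopt = b \<bullet> y - c \<bullet> xopt"
    by (simp only: inner_diff_left inner_transpose_mult xfeas inner_commute[of y])
  show ?thesis
    using 1 2 strong_duality[OF opt] inner_le_infnorm_l1[of yopt "b - A *v x"]
      inner_le_max_violation_l1[OF xfeas(2), of "transpose A *v y - c"]
    by linarith
qed

section \<open>The iterates\<close>

lemma fwlp_p_step:
  assumes "fwlp_p A b c \<xi> \<eta> r x s y" and "1 \<le> k"
  shows "r (k + 1) \<in> Delta_set \<xi>"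
    and "\<And>v. v \<in> Delta_set \<xi> \<Longrightarrow>
      (c - transpose A *v y k) \<bullet> r (k + 1) + (norm (r (k + 1)))\<^sup>2 / (2 * sqrt (real k))
      \<le> (c - transpose A *v y k) \<bullet> v + (norm v)\<^sup>2 / (2 * sqrt (real k))"
    and "x (k + 1) = (real k / (real k + 1)) *\<^sub>R x k + (1 / (real k + 1)) *\<^sub>R r (k + 1)"
    and "\<And>v. v \<in> Gamma_set \<eta> \<Longrightarrow>
      (b - A *v x (k + 1)) \<bullet> v - (norm v)\<^sup>2 / (2 * sqrt (real k))
      \<le> (b - A *v x (k + 1)) \<bullet> s (k + 1) - (norm (s (k + 1)))\<^sup>2 / (2 * sqrt (real k))"
  using assms unfolding fwlp_p_def is_arg_min_linorder is_arg_max_linorder by blast+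

lemma fwlp_p_primal_nonneg:
  assumes alg: "fwlp_p A b c \<xi> \<eta> r x s y" and "0 \<le> x 1" and "1 \<le> k"
  shows "0 \<le> x k"
  using \<open>1 \<le> k\<close>
proof (induction k rule: dec_induct)
  case base
  show ?case by fact
next
  case (step k)
  have "0 \<le> r (k + 1)"
    using fwlp_p_step(1)[OF alg step(1)] by (simp add: Delta_set_def)
  with step fwlp_p_step(3)[OF alg step(1)] show ?case
    by (simp add: less_eq_vec_def)
qed

text \<open>The quantity \<open>fwlp_U\<close> regularises \<open>s k\<close> with \<open>sqrt k\<close> although \<open>s k\<close> is optimal for
  \<open>sqrt (k - 1)\<close>. The larger root subtracts less, so the optimal value of the subproblem
  that was solved remains a lower bound.\<close>

lemma fwlp_U_ge:
  assumes alg: "fwlp_p A b c \<xi> \<eta> r x s y" and "2 \<le> k"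
    and u: "u \<in> Delta_set \<xi>" and v: "v \<in> Gamma_set \<eta>"
  shows "(transpose A *v y k - c) \<bullet> u - (norm u)\<^sup>2 / (2 * sqrt (real k))
      + ((b - A *v x k) \<bullet> v - (norm v)\<^sup>2 / (2 * sqrt (real k - 1)))
      + (c \<bullet> x k - b \<bullet> y k) \<le> fwlp_U A b c r x s y k"
proof -
  have k: "1 \<le> k" "1 \<le> k - 1" "k - 1 + 1 = k" "real (k - 1) = real k - 1"
    using \<open>2 \<le> k\<close> by auto
  have "(norm (s k))\<^sup>2 / (2 * sqrt (real k)) \<le> (norm (s k))\<^sup>2 / (2 * sqrt (real k - 1))"
    using \<open>2 \<le> k\<close> by (intro divide_left_mono) auto
  moreover have "(b - A *v x k) \<bullet> v - (norm v)\<^sup>2 / (2 * sqrt (real k - 1))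
      \<le> (b - A *v x k) \<bullet> s k - (norm (s k))\<^sup>2 / (2 * sqrt (real k - 1))"
    using fwlp_p_step(4)[OF alg k(2) v] unfolding k .
  moreover have "(transpose A *v y k - c) \<bullet> u = - ((c - transpose A *v y k) \<bullet> u)"
    by (simp add: inner_diff_left)
  ultimately show ?thesis
    using fwlp_p_step(2)[OF alg k(1) u]
    by (simp add: fwlp_U_def inner_commute)
qed

lemma fwlp_U_ge_gap:
  assumes "fwlp_p A b c \<xi> \<eta> r x s y" and "2 \<le> k" and "0 < \<xi>" and "0 < \<eta>"
  shows "c \<bullet> x k - b \<bullet> y k \<le> fwlp_U A b c r x s y k"
  using fwlp_U_ge[OF assms(1,2), of 0 0] assms(3,4)
  by (simp add: Delta_set_def Gamma_set_def)

text \<open>The test points contribute \<open>\<xi> D + \<eta> P\<close> to the lower bound on \<open>fwlp_U\<close>, of which the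
  possibly negative duality gap takes back at most half. Both violations are bounded jointly, so
  dropping either one gives the bound on the other.\<close>

lemma fwlp_U_controls_infeasibility:
  fixes A :: "real ^ 'n ^ 'm"
  assumes "0 < \<xi>" and "0 < \<eta>"
    and opt: "optimal_pair A b c xopt yopt"
    and "2 * l1_norm xopt \<le> \<xi>" and "2 * infnorm yopt \<le> \<eta>"
    and alg: "fwlp_p A b c \<xi> \<eta> r x s y" and "0 \<le> x 1" and k: "2 \<le> k"
  shows "\<xi> * max_violation (transpose A *v y k - c) + \<eta> * l1_norm (b - A *v x k)
    \<le> 2 * fwlp_U A b c r x s y k + \<xi>\<^sup>2 / sqrt (real k)
      + real CARD('m) * \<eta>\<^sup>2 / sqrt (real k - 1)"
proof -
  define D where "D = max_violation (transpose A *v y k - c)"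
  define P where "P = l1_norm (b - A *v x k)"
  obtain u where u: "u \<in> Delta_set \<xi>" "(transpose A *v y k - c) \<bullet> u = \<xi> * D"
    "(norm u)\<^sup>2 \<le> \<xi>\<^sup>2"
    unfolding D_def by (rule test_point_primal[OF \<open>0 < \<xi>\<close>])
  obtain v where v: "v \<in> Gamma_set \<eta>" "(b - A *v x k) \<bullet> v = \<eta> * P"
    "(norm v)\<^sup>2 \<le> real CARD('m) * \<eta>\<^sup>2"
    unfolding P_def by (rule test_point_dual[OF \<open>0 < \<eta>\<close>])
  have nu: "2 * ((norm u)\<^sup>2 / (2 * sqrt (real k))) \<le> \<xi>\<^sup>2 / sqrt (real k)"
    using divide_right_mono[OF u(3), of "sqrt (real k)"] by simp
  have nv: "2 * ((norm v)\<^sup>2 / (2 * sqrt (real k - 1)))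
      \<le> real CARD('m) * \<eta>\<^sup>2 / sqrt (real k - 1)"
    using divide_right_mono[OF v(3), of "sqrt (real k - 1)"] k by simp
  have "0 \<le> x k"
    using fwlp_p_primal_nonneg[OF alg \<open>0 \<le> x 1\<close>] k by simp
  then have gap: "- (infnorm yopt * P) - D * l1_norm xopt \<le> c \<bullet> x k - b \<bullet> y k"
    unfolding D_def P_def by (rule duality_gap_lower_bound[OF opt])
  have "2 * (infnorm yopt * P) \<le> \<eta> * P"
    using mult_right_mono[OF \<open>2 * infnorm yopt \<le> \<eta>\<close>, of P] by (simp add: P_def l1_norm_nonneg)
  moreover have "2 * (D * l1_norm xopt) \<le> \<xi> * D"
    using mult_left_mono[OF \<open>2 * l1_norm xopt \<le> \<xi>\<close>, of D]
    by (simp add: D_def max_violation_nonneg mult.commute mult.left_commute)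
  moreover have "\<xi> * D - (norm u)\<^sup>2 / (2 * sqrt (real k))
      + (\<eta> * P - (norm v)\<^sup>2 / (2 * sqrt (real k - 1)))
      + (c \<bullet> x k - b \<bullet> y k) \<le> fwlp_U A b c r x s y k"
    using fwlp_U_ge[OF alg k u(1) v(1)] unfolding u(2) v(2) .
  ultimately show ?thesis
    using nu nv gap unfolding D_def[symmetric] P_def[symmetric]
    by linarith
qed

theorem theorem2:
  fixes A :: "real ^ 'n ^ 'm" and b :: "real ^ 'm" and c :: "real ^ 'n"
    and \<xi> \<eta> :: real
    and r x :: "nat \<Rightarrow> real ^ 'n" and s y :: "nat \<Rightarrow> real ^ 'm"
    and xopt :: "real ^ 'n" and yopt :: "real ^ 'm"
    and k :: nat
  assumes "\<xi> > 0" and "\<eta> > 0"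
    and "optimal_pair A b c xopt yopt"
    and "\<xi> \<ge> 2 * l1_norm xopt" and "\<eta> \<ge> 2 * infnorm yopt"
    and "fwlp_p A b c \<xi> \<eta> r x s y"
    and "0 \<le> x 1"
    and "k \<ge> 2"
  shows "0 \<le> x k \<and>
    l1_norm (b - A *v x k)
      \<le> 2 * fwlp_U A b c r x s y k / \<eta> + \<xi>\<^sup>2 / (\<eta> * sqrt (real k))
        + real CARD('m) * \<eta> / sqrt (real k - 1) \<and>
    max 0 (MAX j\<in>UNIV. axis j 1 \<bullet> (transpose A *v y k - c))
      \<le> 2 * fwlp_U A b c r x s y k / \<xi> + \<xi> / sqrt (real k)
        + real CARD('m) * \<eta>\<^sup>2 / (\<xi> * sqrt (real k - 1)) \<and>
    c \<bullet> x k - b \<bullet> y k \<le> fwlp_U A b c r x s y k"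
proof -
  define D where "D = max_violation (transpose A *v y k - c)"
  define P where "P = l1_norm (b - A *v x k)"
  define U where "U = fwlp_U A b c r x s y k"
  have main: "\<xi> * D + \<eta> * P
      \<le> 2 * U + \<xi>\<^sup>2 / sqrt (real k) + real CARD('m) * \<eta>\<^sup>2 / sqrt (real k - 1)"
    unfolding D_def P_def U_def using assms by (intro fwlp_U_controls_infeasibility) auto
  have "0 \<le> \<xi> * D" "0 \<le> \<eta> * P"
    using assms(1,2) by (simp_all add: D_def P_def max_violation_nonneg l1_norm_nonneg)
  then have "\<eta> * P \<le> \<eta> * (2 * U / \<eta> + \<xi>\<^sup>2 / (\<eta> * sqrt (real k))
      + real CARD('m) * \<eta> / sqrt (real k - 1))"
    and "\<xi> * D \<le> \<xi> * (2 * U / \<xi> + \<xi> / sqrt (real k)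
      + real CARD('m) * \<eta>\<^sup>2 / (\<xi> * sqrt (real k - 1)))"
    using main assms(1,2) by (simp_all add: distrib_left power2_eq_square mult.left_commute)
  then have "P \<le> 2 * U / \<eta> + \<xi>\<^sup>2 / (\<eta> * sqrt (real k)) + real CARD('m) * \<eta> / sqrt (real k - 1)"
    and "D \<le> 2 * U / \<xi> + \<xi> / sqrt (real k) + real CARD('m) * \<eta>\<^sup>2 / (\<xi> * sqrt (real k - 1))"
    using assms(1,2) by (simp_all only: mult_le_cancel_left_pos)
  moreover have "0 \<le> x k"
    using fwlp_p_primal_nonneg[OF assms(6,7)] assms(8) by simp
  moreover have "c \<bullet> x k - b \<bullet> y k \<le> U"
    unfolding U_def using fwlp_U_ge_gap[OF assms(6,8,1,2)] .
  ultimately show ?thesis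
    unfolding D_def P_def U_def max_violation_def by blast
qed

end
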